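(* Let $\tau$ be a finite relational vocabulary, $\mathcal{Q}$ a finite set of generalized quantifiers of width $1$ and type $(1)$, $\mathcal{A}$ and $\mathcal{B}$ classes of $\tau$-pairs, and $s\in\mathbb{Z}_+$. Then Player $\mathbb{I}$ has a winning strategy in the $\mathrm{FS}_s\{\mathcal{Q}\}(\mathcal{A},\mathcal{B})$-game if and only if $\mathcal{A}$ and $\mathcal{B}$ are separable by a formula of $\mathrm{FO}(\mathcal{Q})$ of size $\leq s$.
   Context: **Logic.** $\tau$ is a finite set of relation symbols with arities in $\mathbb{N}$. A $\tau$-model $\mathfrak{A}$ has a non-empty, possibly infinite domain $A$ and a relation $R^{\mathfrak{A}}\subseteq A^k$ for each $k$-ary $R\in\tau$. $\mathrm{VAR}$ is a countably infinite set of variables. An assignment over $\mathfrak{A}$ is a (possibly empty) function $f:X\to A$ with $X\subseteq\mathrm{VAR}$ finite; $f\frac{a}{x}$ is the assignment with domain $\mathrm{dom}(f)\cup\{x\}$ that maps $x$ to $a$ and agrees with $f$ elsewhere. A generalized quantifier of width $1$ and type $(1)$ is an isomorphism-closed class $Q$ of structures $(D,P)$ with $P\subseteq D$. For a finite set $\mathcal{Q}$ of these (which need not contain $\exists$ or $\forall$), $\mathrm{FO}(\mathcal{Q})$ is built from the atomic formulas $x=y$ and $R(x_1,\dots,x_k)$ using $\neg$, $\land$ and $Qx\,\varphi$ for $Q\in\mathcal{Q}$, $x\in\mathrm{VAR}$. Semantics: atoms and connectives as usual, and $\mathfrak{A},f\models Qx\,\varphi$ iff $(A,\|\varphi\|^{\mathfrak{A},f}_x)\in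 Q$, where $\|\varphi\|^{\mathfrak{A},f}_x=\{a\in A\mid \mathfrak{A},f\frac{a}{x}\models\varphi\}$; here $\mathrm{dom}(f)$ contains all free variables of the formula being evaluated. **Size.** $s(\varphi)=1$ for atomic $\varphi$; $s(\neg\varphi)=s(\varphi)+1$; $s(\varphi\land\psi)=s(\varphi)+s(\psi)$; $s(Qx\,\varphi)=s(\varphi)+1$. **Separability.** A $\tau$-pair is a pair $(\mathfrak{A},f)$ with $\mathfrak{A}$ a $\tau$-model and $f$ an assignment over $\mathfrak{A}$. A formula $\varphi$ separates classes $\mathcal{A},\mathcal{B}$ of $\tau$-pairs (possibly empty) if $\mathfrak{A},f\models\varphi$ for all $(\mathfrak{A},f)\in\mathcal{A}$ and $\mathfrak{B},g\not\models\varphi$ for all $(\mathfrak{B},g)\in\mathcal{B}$. **The game.** $\mathrm{FS}_s\{\mathcal{Q}\}(\mathcal{A},\mathcal{B})$ is a two-player game starting in position $(s,\mathcal{A},\mathcal{B})$. A round from position $(s_i,\mathcal{A}_i,\mathcal{B}_i)$ goes as follows. 1. If some atomic formula separates $\mathcal{A}_i$ and $\mathcal{B}_i$, Player $\mathbb{I}$ wins. 2. Otherwise, if $s_i=1$, Player $\mathbb{II}$ wins. 3. Otherwise Player $\mathbb{I}$ chooses one of: (a) *Swap.* The next position is $(s_i-1,\mathcal{B}_i,\mathcal{A}_i)$. (b) *Right splitting.* Player $\mathbb{I}$ chooses $u,v\in\mathbb{Z}_+$ with $u+v=s_i$ and (possibly overlapping) $\mathcal{C},\mathcal{D}\subseteq\mathcal{B}_i$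 with $\mathcal{C}\cup\mathcal{D}=\mathcal{B}_i$; Player $\mathbb{II}$ chooses whether the next position is $(u,\mathcal{A}_i,\mathcal{C})$ or $(v,\mathcal{A}_i,\mathcal{D})$. (c) *Supplementing.* Player $\mathbb{I}$ chooses $Q\in\mathcal{Q}$, $x\in\mathrm{VAR}$ and a function $P$ assigning to each $(\mathfrak{C},h)\in\mathcal{A}_i\cup\mathcal{B}_i$ a set $P(\mathfrak{C},h)\subseteq C$, such that $(A,P(\mathfrak{A},f))\in Q$ for all $(\mathfrak{A},f)\in\mathcal{A}_i$ and $(B,P(\mathfrak{B},g))\notin Q$ for all $(\mathfrak{B},g)\in\mathcal{B}_i$ (if no such $P$ exists, this move is unavailable). The next position is $(s_i-1,\mathcal{C}^+,\mathcal{C}^-)$, where $\mathcal{C}^+=\{(\mathfrak{C},h\frac{v}{x})\mid(\mathfrak{C},h)\in\mathcal{A}_i\cup\mathcal{B}_i,\ v\in P(\mathfrak{C},h)\}$ and $\mathcal{C}^-=\{(\mathfrak{C},h\frac{v}{x})\mid(\mathfrak{C},h)\in\mathcal{A}_i\cup\mathcal{B}_i,\ v\in C\setminus P(\mathfrak{C},h)\}$.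
   Formalization: The claim fails if assignments have different domains and all free variables must lie in each domain; here a conjunction may also be evaluated as false when one conjunct is defined and false. For assignments with a common domain, separability is unchanged. *)

theory Defs
  imports Main
begin

section \<open>Models, assignments, formulas\<close>

text \<open>
  A vocabulary is a set \<open>\<tau>\<close> of relation symbols together with an arity function \<open>ar\<close>.
  Models carry an explicit domain inside a universe type \<open>'a\<close>, so that one class may contain
  models of different (finite or infinite) cardinalities. The variables are the natural numbers,
  and an assignment is a map with finite domain.
\<close>

type_synonym var = nat

record ('r, 'a) model =
  carrier :: "'a set"
  rel :: "'r \<Rightarrow> 'a list set"

type_synonym 'a assignment = "var \<rightharpoonup> 'a"
type_synonym ('r, 'a) pair = "('r, 'a) model \<times> 'a assignment"
type_synonym 'a quantifier = "('a set \<times> 'a set) set"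

text \<open>The last conjunct makes two models that interpret \<open>\<tau>\<close> alike equal.\<close>

definition is_model :: "'r set \<Rightarrow> ('r \<Rightarrow> nat) \<Rightarrow> ('r, 'a) model \<Rightarrow> bool" where
  "is_model \<tau> ar M \<longleftrightarrow> carrier M \<noteq> {} \<and>
     (\<forall>R\<in>\<tau>. rel M R \<subseteq> {as. length as = ar R \<and> set as \<subseteq> carrier M}) \<and>
     (\<forall>R. R \<notin> \<tau> \<longrightarrow> rel M R = {})"

definition pairs :: "'r set \<Rightarrow> ('r \<Rightarrow> nat) \<Rightarrow> ('r, 'a) pair set" where
  "pairs \<tau> ar = {(M, f). is_model \<tau> ar M \<and> finite (dom f) \<and> ran f \<subseteq> carrier M}"

definition is_quantifier :: "'a quantifier \<Rightarrow> bool" where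
  "is_quantifier Q \<longleftrightarrow> (\<forall>(D, P)\<in>Q. P \<subseteq> D) \<and>
     (\<forall>D P D' \<pi>. (D, P) \<in> Q \<and> bij_betw \<pi> D D' \<longrightarrow> (D', \<pi> ` P) \<in> Q)"

datatype ('r, 'a) fm =
    Eq var var
  | Rel 'r "var list"
  | Neg "('r, 'a) fm"
  | And "('r, 'a) fm" "('r, 'a) fm"
  | Quant "'a quantifier" var "('r, 'a) fm"

fun atomic :: "('r, 'a) fm \<Rightarrow> bool" where
  "atomic (Eq x y) = True"
| "atomic (Rel R xs) = True"
| "atomic _ = False"

inductive_set FO :: "'r set \<Rightarrow> ('r \<Rightarrow> nat) \<Rightarrow> 'a quantifier set \<Rightarrow> ('r, 'a) fm set"
  for \<tau> ar QQ where
  "Eq x y \<in> FO \<tau> ar QQ"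
| "R \<in> \<tau> \<Longrightarrow> length xs = ar R \<Longrightarrow> Rel R xs \<in> FO \<tau> ar QQ"
| "\<phi> \<in> FO \<tau> ar QQ \<Longrightarrow> Neg \<phi> \<in> FO \<tau> ar QQ"
| "\<phi> \<in> FO \<tau> ar QQ \<Longrightarrow> \<psi> \<in> FO \<tau> ar QQ \<Longrightarrow> And \<phi> \<psi> \<in> FO \<tau> ar QQ"
| "Q \<in> QQ \<Longrightarrow> \<phi> \<in> FO \<tau> ar QQ \<Longrightarrow> Quant Q x \<phi> \<in> FO \<tau> ar QQ"

primrec fm_size :: "('r, 'a) fm \<Rightarrow> nat" where
  "fm_size (Eq x y) = 1"
| "fm_size (Rel R xs) = 1"
| "fm_size (Neg \<phi>) = fm_size \<phi> + 1"
| "fm_size (And \<phi> \<psi>) = fm_size \<phi> + fm_size \<psi>"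
| "fm_size (Quant Q x \<phi>) = fm_size \<phi> + 1"

primrec fv :: "('r, 'a) fm \<Rightarrow> var set" where
  "fv (Eq x y) = {x, y}"
| "fv (Rel R xs) = set xs"
| "fv (Neg \<phi>) = fv \<phi>"
| "fv (And \<phi> \<psi>) = fv \<phi> \<union> fv \<psi>"
| "fv (Quant Q x \<phi>) = fv \<phi> - {x}"

text \<open>Truth is meaningful only under the proviso \<open>defined\<close> below.\<close>

primrec sat :: "('r, 'a) model \<Rightarrow> 'a assignment \<Rightarrow> ('r, 'a) fm \<Rightarrow> bool" where
  "sat M f (Eq x y) \<longleftrightarrow> f x = f y"
| "sat M f (Rel R xs) \<longleftrightarrow> map (\<lambda>x. the (f x)) xs \<in> rel M R"
| "sat M f (Neg \<phi>) \<longleftrightarrow> \<not> sat M f \<phi>"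
| "sat M f (And \<phi> \<psi>) \<longleftrightarrow> sat M f \<phi> \<and> sat M f \<psi>"
| "sat M f (Quant Q x \<phi>) \<longleftrightarrow> (carrier M, {a \<in> carrier M. sat M (f(x \<mapsto> a)) \<phi>}) \<in> Q"

text \<open>
  The proviso that the assignment is defined on the free variables of the formula being
  evaluated. It is imposed along the evaluation: an atom needs all its variables, while a
  conjunction one conjunct of which is already refuted does not need the other conjunct. The
  latter matters because assignments in one class may have different domains. Splitting
  \<open>\<B> = \<C> \<union> \<D>\<close> may lead to a formula \<open>\<phi>\<close> that is refuted on \<open>\<C>\<close> and a formula \<open>\<psi>\<close> that is
  refuted on \<open>\<D>\<close> although \<open>\<psi>\<close> has free variables on which the assignments of \<open>\<C>\<close> are
  undefined; with \<open>fv (And \<phi> \<psi>) \<subseteq> dom f\<close> as proviso, \<open>And \<phi> \<psi>\<close> would then not separate.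
  \<open>defined_if_fv\<close> and \<open>separable_iff_fv\<close> below relate this to the stricter proviso \<open>fv \<phi> \<subseteq> dom f\<close>:
  the latter implies \<open>defined\<close>, and if all assignments have the same domain, both provisos make
  the same classes separable, with the same formula sizes.
\<close>

primrec defined :: "('r, 'a) model \<Rightarrow> 'a assignment \<Rightarrow> ('r, 'a) fm \<Rightarrow> bool" where
  "defined M f (Eq x y) \<longleftrightarrow> x \<in> dom f \<and> y \<in> dom f"
| "defined M f (Rel R xs) \<longleftrightarrow> set xs \<subseteq> dom f"
| "defined M f (Neg \<phi>) \<longleftrightarrow> defined M f \<phi>"
| "defined M f (And \<phi> \<psi>) \<longleftrightarrow>
     (defined M f \<phi> \<and> defined M f \<psi>) \<or>
     (defined M f \<phi> \<and> \<not> sat M f \<phi>) \<or>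
     (defined M f \<psi> \<and> \<not> sat M f \<psi>)"
| "defined M f (Quant Q x \<phi>) \<longleftrightarrow> (\<forall>a\<in>carrier M. defined M (f(x \<mapsto> a)) \<phi>)"

definition separates ::
    "('r, 'a) fm \<Rightarrow> ('r, 'a) pair set \<Rightarrow> ('r, 'a) pair set \<Rightarrow> bool" where
  "separates \<phi> \<A> \<B> \<longleftrightarrow>
     (\<forall>(M, f)\<in>\<A>. defined M f \<phi> \<and> sat M f \<phi>) \<and>
     (\<forall>(M, f)\<in>\<B>. defined M f \<phi> \<and> \<not> sat M f \<phi>)"

lemma defined_if_fv: "fv \<phi> \<subseteq> dom f \<Longrightarrow> defined M f \<phi>"
proof (induction \<phi> arbitrary: f)
  case (Quant Q x \<phi>)
  then show ?case by (auto intro!: Quant.IH)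
qed auto

section \<open>The game\<close>

type_synonym ('r, 'a) position = "nat \<times> ('r, 'a) pair set \<times> ('r, 'a) pair set"

datatype ('r, 'a) move =
    Swap
  | Split nat nat "('r, 'a) pair set" "('r, 'a) pair set"
  | Supplement "'a quantifier" var "('r, 'a) pair \<Rightarrow> 'a set"

definition supp_in ::
    "var \<Rightarrow> (('r, 'a) pair \<Rightarrow> 'a set) \<Rightarrow> ('r, 'a) pair set \<Rightarrow> ('r, 'a) pair set" where
  "supp_in x P \<C> = {(M, h(x \<mapsto> v)) | M h v. (M, h) \<in> \<C> \<and> v \<in> P (M, h)}"

definition supp_out ::
    "var \<Rightarrow> (('r, 'a) pair \<Rightarrow> 'a set) \<Rightarrow> ('r, 'a) pair set \<Rightarrow> ('r, 'a) pair set" where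
  "supp_out x P \<C> = {(M, h(x \<mapsto> v)) | M h v. (M, h) \<in> \<C> \<and> v \<in> carrier M - P (M, h)}"

text \<open>\<open>legal\<close> does not mention that the position is not yet decided; see \<open>consistent\<close>.\<close>

fun legal :: "'a quantifier set \<Rightarrow> ('r, 'a) position \<Rightarrow> ('r, 'a) move \<Rightarrow> bool" where
  "legal QQ (s, \<A>, \<B>) Swap \<longleftrightarrow> True"
| "legal QQ (s, \<A>, \<B>) (Split u v \<C> \<D>) \<longleftrightarrow>
     u \<ge> 1 \<and> v \<ge> 1 \<and> u + v = s \<and> \<C> \<subseteq> \<B> \<and> \<D> \<subseteq> \<B> \<and> \<C> \<union> \<D> = \<B>"
| "legal QQ (s, \<A>, \<B>) (Supplement Q x P) \<longleftrightarrow>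
     Q \<in> QQ \<and> (\<forall>(M, h)\<in>\<A> \<union> \<B>. P (M, h) \<subseteq> carrier M) \<and>
     (\<forall>(M, f)\<in>\<A>. (carrier M, P (M, f)) \<in> Q) \<and>
     (\<forall>(M, g)\<in>\<B>. (carrier M, P (M, g)) \<notin> Q)"

text \<open>The possible next positions; Player II chooses one of them.\<close>

fun successors :: "('r, 'a) position \<Rightarrow> ('r, 'a) move \<Rightarrow> ('r, 'a) position set" where
  "successors (s, \<A>, \<B>) Swap = {(s - 1, \<B>, \<A>)}"
| "successors (s, \<A>, \<B>) (Split u v \<C> \<D>) = {(u, \<A>, \<C>), (v, \<A>, \<D>)}"
| "successors (s, \<A>, \<B>) (Supplement Q x P) =
     {(s - 1, supp_in x P (\<A> \<union> \<B>), supp_out x P (\<A> \<union> \<B>))}"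

definition won_by_I ::
    "'r set \<Rightarrow> ('r \<Rightarrow> nat) \<Rightarrow> 'a quantifier set \<Rightarrow> ('r, 'a) position \<Rightarrow> bool" where
  "won_by_I \<tau> ar QQ = (\<lambda>(s, \<A>, \<B>). \<exists>\<alpha>\<in>FO \<tau> ar QQ. atomic \<alpha> \<and> separates \<alpha> \<A> \<B>)"

definition won_by_II ::
    "'r set \<Rightarrow> ('r \<Rightarrow> nat) \<Rightarrow> 'a quantifier set \<Rightarrow> ('r, 'a) position \<Rightarrow> bool" where
  "won_by_II \<tau> ar QQ p \<longleftrightarrow> \<not> won_by_I \<tau> ar QQ p \<and> fst p = 1"

text \<open>
  A strategy of Player I maps every history (the nonempty list of positions visited so far) to a
  move. \<open>consistent \<tau> ar QQ \<sigma> p h\<close>: from the initial position \<open>p\<close>, the history \<open>h\<close> can arise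
  when Player I follows \<open>\<sigma>\<close>.
\<close>

type_synonym ('r, 'a) strategy = "('r, 'a) position list \<Rightarrow> ('r, 'a) move"

inductive consistent ::
    "'r set \<Rightarrow> ('r \<Rightarrow> nat) \<Rightarrow> 'a quantifier set \<Rightarrow> ('r, 'a) strategy \<Rightarrow>
     ('r, 'a) position \<Rightarrow> ('r, 'a) position list \<Rightarrow> bool"
  for \<tau> ar QQ \<sigma> p where
  start: "consistent \<tau> ar QQ \<sigma> p [p]"
| step: "consistent \<tau> ar QQ \<sigma> p h \<Longrightarrow>
     \<not> won_by_I \<tau> ar QQ (last h) \<Longrightarrow> \<not> won_by_II \<tau> ar QQ (last h) \<Longrightarrow>
     legal QQ (last h) (\<sigma> h) \<Longrightarrow> q \<in> successors (last h) (\<sigma> h) \<Longrightarrow>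
     consistent \<tau> ar QQ \<sigma> p (h @ [q])"

text \<open>
  The resource strictly decreases and stays positive along a play, so no play is infinite. Hence
  \<open>\<sigma>\<close> wins iff every history arising from it has either been won by Player I or is undecided and
  continued by \<open>\<sigma>\<close> with a legal move.
\<close>

definition winning_strategy ::
    "'r set \<Rightarrow> ('r \<Rightarrow> nat) \<Rightarrow> 'a quantifier set \<Rightarrow> ('r, 'a) strategy \<Rightarrow>
     ('r, 'a) position \<Rightarrow> bool" where
  "winning_strategy \<tau> ar QQ \<sigma> p \<longleftrightarrow>
     (\<forall>h. consistent \<tau> ar QQ \<sigma> p h \<longrightarrow>
        won_by_I \<tau> ar QQ (last h) \<or>
        (\<not> won_by_II \<tau> ar QQ (last h) \<and> legal QQ (last h) (\<sigma> h)))"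

section \<open>Comparison with the stricter proviso on free variables\<close>

lemma separable_fv:
  assumes "\<phi> \<in> FO \<tau> ar QQ" "separates \<phi> \<A> \<B>"
    and "\<forall>(M, f)\<in>\<A> \<union> \<B>. carrier M \<noteq> {} \<and> dom f = X"
  shows "\<exists>\<psi>\<in>FO \<tau> ar QQ. fm_size \<psi> \<le> fm_size \<phi> \<and> separates \<psi> \<A> \<B> \<and>
           (\<forall>(M, f)\<in>\<A> \<union> \<B>. fv \<psi> \<subseteq> dom f)"
  using assms
proof (induction \<phi> arbitrary: \<A> \<B> X rule: FO.induct)
  case (1 x y)
  have "fv (Eq x y) \<subseteq> dom f" if "(M, f) \<in> \<A> \<union> \<B>" for M f
  proof -
    have "defined M f (Eq x y)"
      using that 1(1) unfolding separates_def by fast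
    then show ?thesis by simp
  qed
  moreover have "Eq x y \<in> FO \<tau> ar QQ" by (rule FO.intros)
  ultimately show ?case using 1(1) by (intro bexI[of _ "Eq x y"] conjI) auto
next
  case (2 R xs)
  have "fv (Rel R xs) \<subseteq> dom f" if "(M, f) \<in> \<A> \<union> \<B>" for M f
  proof -
    have "defined M f (Rel R xs)"
      using that 2(3) unfolding separates_def by fast
    then show ?thesis by simp
  qed
  moreover have "Rel R xs \<in> FO \<tau> ar QQ" using 2(1,2) by (rule FO.intros)
  ultimately show ?case using 2(3) by (intro bexI[of _ "Rel R xs"] conjI) auto
next
  case (3 \<phi>)
  have sep: "separates \<phi> \<B> \<A>" using 3(3) by (auto simp: separates_def)
  obtain \<psi> where \<psi>: "\<psi> \<in> FO \<tau> ar QQ" "fm_size \<psi> \<le> fm_size \<phi>" "separates \<psi> \<B> \<A>"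
      "\<forall>(M, f)\<in>\<B> \<union> \<A>. fv \<psi> \<subseteq> dom f"
    using 3(2)[OF sep 3(4)[unfolded Un_commute[of \<A> \<B>]]] by (elim bexE conjE)
  have "\<forall>(M, f)\<in>\<A> \<union> \<B>. fv (Neg \<psi>) \<subseteq> dom f"
    using \<psi>(4) by (simp only: Un_commute fv.simps)
  moreover have "separates (Neg \<psi>) \<A> \<B>" using \<psi>(3) by (simp add: separates_def)
  moreover have "Neg \<psi> \<in> FO \<tau> ar QQ" using \<psi>(1) by (rule FO.intros)
  moreover have "fm_size (Neg \<psi>) \<le> fm_size (Neg \<phi>)" using \<psi>(2) by simp
  ultimately show ?case by (intro bexI[of _ "Neg \<psi>"] conjI)
next
  case (4 \<phi>1 \<phi>2)
  define C where "C = {(M, f)\<in>\<B>. defined M f \<phi>1 \<and> \<not> sat M f \<phi>1}"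
  define D where "D = {(M, f)\<in>\<B>. defined M f \<phi>2 \<and> \<not> sat M f \<phi>2}"
  have B: "\<B> = C \<union> D" using 4(5) by (auto simp: C_def D_def separates_def)
  have s1: "separates \<phi>1 \<A> C" and s2: "separates \<phi>2 \<A> D"
    using 4(5) by (auto simp: C_def D_def separates_def)
  have sub: "\<A> \<union> C \<subseteq> \<A> \<union> \<B>" "\<A> \<union> D \<subseteq> \<A> \<union> \<B>" using B by blast+
  have d1: "\<forall>(M, f)\<in>\<A> \<union> C. carrier M \<noteq> {} \<and> dom f = X"
    by (rule ballI, rule bspec[OF 4(6)], rule subsetD[OF sub(1)])
  have d2: "\<forall>(M, f)\<in>\<A> \<union> D. carrier M \<noteq> {} \<and> dom f = X"
    by (rule ballI, rule bspec[OF 4(6)], rule subsetD[OF sub(2)])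
  obtain \<psi>1 where
    p1: "\<psi>1 \<in> FO \<tau> ar QQ" "fm_size \<psi>1 \<le> fm_size \<phi>1" "separates \<psi>1 \<A> C"
      "\<forall>(M, f)\<in>\<A> \<union> C. fv \<psi>1 \<subseteq> dom f"
    using 4(3)[OF s1 d1] by (elim bexE conjE)
  obtain \<psi>2 where
    p2: "\<psi>2 \<in> FO \<tau> ar QQ" "fm_size \<psi>2 \<le> fm_size \<phi>2" "separates \<psi>2 \<A> D"
      "\<forall>(M, f)\<in>\<A> \<union> D. fv \<psi>2 \<subseteq> dom f"
    using 4(4)[OF s2 d2] by (elim bexE conjE)
  consider "\<A> \<union> C = {}" | "\<A> \<union> D = {}" | "\<A> \<union> C \<noteq> {}" "\<A> \<union> D \<noteq> {}" by blast
  then show ?case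
  proof cases
    case 1
    then have "\<A> \<union> \<B> = \<A> \<union> D" "\<B> = D" using B by auto
    then show ?thesis
      using p2 by (intro bexI[of _ \<psi>2] conjI) (simp_all only: fm_size.simps trans_le_add2)
  next
    case 2
    then have "\<A> \<union> \<B> = \<A> \<union> C" "\<B> = C" using B by auto
    then show ?thesis
      using p1 by (intro bexI[of _ \<psi>1] conjI) (simp_all only: fm_size.simps trans_le_add1)
  next
    case 3
    have "fv \<psi>1 \<subseteq> X"
    proof -
      obtain M f where "(M, f) \<in> \<A> \<union> C" using 3(1) by fast
      then have "fv \<psi>1 \<subseteq> dom f" "dom f = X"
        using bspec[OF p1(4)] bspec[OF d1] by fast+
      then show ?thesis by simp
    qed
    moreover have "fv \<psi>2 \<subseteq> X"
    proof -
      obtain M f where "(M, f) \<in> \<A> \<union> D" using 3(2) by fast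
      then have "fv \<psi>2 \<subseteq> dom f" "dom f = X"
        using bspec[OF p2(4)] bspec[OF d2] by fast+
      then show ?thesis by simp
    qed
    ultimately have fv: "\<forall>(M, f)\<in>\<A> \<union> \<B>. fv (And \<psi>1 \<psi>2) \<subseteq> dom f"
      using 4(6) by (simp add: case_prod_beta)
    have "separates (And \<psi>1 \<psi>2) \<A> \<B>"
      using p1(3) p2(3) B by (fastforce simp: separates_def)
    moreover have "And \<psi>1 \<psi>2 \<in> FO \<tau> ar QQ" using p1(1) p2(1) by (rule FO.intros)
    moreover have "fm_size (And \<psi>1 \<psi>2) \<le> fm_size (And \<phi>1 \<phi>2)" using p1(2) p2(2) by simp
    ultimately show ?thesis using fv by (intro bexI[of _ "And \<psi>1 \<psi>2"] conjI)
  qed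
next
  case (5 Q \<phi> x)
  define P where "P = (\<lambda>(M, f). {a \<in> carrier M. sat M (f(x \<mapsto> a)) \<phi>})"
  define Cp where "Cp = supp_in x P (\<A> \<union> \<B>)"
  define Cm where "Cm = supp_out x P (\<A> \<union> \<B>)"
  have mem: "(M, f(x \<mapsto> a)) \<in> (if sat M (f(x \<mapsto> a)) \<phi> then Cp else Cm)"
    if "(M, f) \<in> \<A> \<union> \<B>" "a \<in> carrier M" for M f a
    using that unfolding Cp_def Cm_def supp_in_def supp_out_def P_def by auto
  have def: "defined M (f(x \<mapsto> a)) \<phi>" if "(M, f) \<in> \<A> \<union> \<B>" "a \<in> carrier M" for M f a
    using 5(4) that by (auto simp: separates_def)
  have sep: "separates \<phi> Cp Cm"
    unfolding separates_def Cp_def Cm_def supp_in_def supp_out_def P_def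
    using def by auto
  have X': "\<forall>(M, f)\<in>Cp \<union> Cm. carrier M \<noteq> {} \<and> dom f = insert x X"
  proof -
    have "carrier M \<noteq> {} \<and> dom (f(x \<mapsto> a)) = insert x X" if "(M, f) \<in> \<A> \<union> \<B>" for M f a
      using bspec[OF 5(5) that] by simp
    note * = this
    show ?thesis
    proof (intro ballI, clarify)
      fix M g assume "(M, g) \<in> Cp \<union> Cm"
      then obtain h v where "(M, h) \<in> \<A> \<union> \<B>" "g = h(x \<mapsto> v)"
        unfolding Cp_def Cm_def supp_in_def supp_out_def by blast
      then show "carrier M \<noteq> {} \<and> dom g = insert x X" using * by simp
    qed
  qed
  obtain \<psi> where
    p: "\<psi> \<in> FO \<tau> ar QQ" "fm_size \<psi> \<le> fm_size \<phi>" "separates \<psi> Cp Cm"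
      "\<forall>(M, f)\<in>Cp \<union> Cm. fv \<psi> \<subseteq> dom f"
    using 5(3)[OF sep X'] by (elim bexE conjE)
  have eq: "sat M (f(x \<mapsto> a)) \<psi> = sat M (f(x \<mapsto> a)) \<phi>"
    if "(M, f) \<in> \<A> \<union> \<B>" "a \<in> carrier M" for M f a
    using mem[OF that] p(3) unfolding separates_def by (auto split: if_splits)
  have fv: "fv (Quant Q x \<psi>) \<subseteq> dom f" if "(M, f) \<in> \<A> \<union> \<B>" for M f
  proof -
    have "carrier M \<noteq> {}" using bspec[OF 5(5) that] by simp
    then obtain a where a: "a \<in> carrier M" by fast
    have "(M, f(x \<mapsto> a)) \<in> Cp \<union> Cm" using mem[OF that a] by (auto split: if_splits)
    then have "fv \<psi> \<subseteq> dom (f(x \<mapsto> a))" using bspec[OF p(4)] by fast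
    then show ?thesis by auto
  qed
  have seq: "sat M f (Quant Q x \<psi>) = sat M f (Quant Q x \<phi>)" if "(M, f) \<in> \<A> \<union> \<B>" for M f
    using eq[OF that] by (simp cong: conj_cong)
  have "separates (Quant Q x \<psi>) \<A> \<B>"
    using 5(4) seq defined_if_fv[OF fv] unfolding separates_def by fast
  moreover have "Quant Q x \<psi> \<in> FO \<tau> ar QQ" using 5(1) p(1) by (rule FO.intros)
  moreover have "\<forall>(M, f)\<in>\<A> \<union> \<B>. fv (Quant Q x \<psi>) \<subseteq> dom f" using fv by fast
  moreover have "fm_size (Quant Q x \<psi>) \<le> fm_size (Quant Q x \<phi>)" using p(2) by simp
  ultimately show ?case by (intro bexI[of _ "Quant Q x \<psi>"] conjI)
qed

lemma separable_iff_fv: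
  assumes "\<A> \<subseteq> pairs \<tau> ar" "\<B> \<subseteq> pairs \<tau> ar"
    and "\<forall>(M, f)\<in>\<A> \<union> \<B>. dom f = X"
  shows "(\<exists>\<phi>\<in>FO \<tau> ar QQ. fm_size \<phi> \<le> s \<and> separates \<phi> \<A> \<B>) \<longleftrightarrow>
         (\<exists>\<phi>\<in>FO \<tau> ar QQ. fm_size \<phi> \<le> s \<and>
            (\<forall>(M, f)\<in>\<A> \<union> \<B>. fv \<phi> \<subseteq> dom f) \<and>
            (\<forall>(M, f)\<in>\<A>. sat M f \<phi>) \<and> (\<forall>(M, f)\<in>\<B>. \<not> sat M f \<phi>))"
    (is "?L \<longleftrightarrow> ?R")
proof
  assume ?L
  then obtain \<phi> where \<phi>: "\<phi> \<in> FO \<tau> ar QQ" "fm_size \<phi> \<le> s" "separates \<phi> \<A> \<B>"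
    by (elim bexE conjE)
  have "\<forall>(M, f)\<in>\<A> \<union> \<B>. carrier M \<noteq> {} \<and> dom f = X"
  proof (rule ballI)
    fix p assume p: "p \<in> \<A> \<union> \<B>"
    then have "p \<in> pairs \<tau> ar" using assms(1,2) by fast
    then show "case p of (M, f) \<Rightarrow> carrier M \<noteq> {} \<and> dom f = X"
      using bspec[OF assms(3) p] by (simp add: pairs_def is_model_def case_prod_beta)
  qed
  from separable_fv[OF \<phi>(1,3) this] obtain \<psi> where
    \<psi>: "\<psi> \<in> FO \<tau> ar QQ" "fm_size \<psi> \<le> fm_size \<phi>" "separates \<psi> \<A> \<B>"
      "\<forall>(M, f)\<in>\<A> \<union> \<B>. fv \<psi> \<subseteq> dom f" by (elim bexE conjE)
  have "fm_size \<psi> \<le> s" using \<psi>(2) \<phi>(2) by simp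
  moreover have "\<forall>(M, f)\<in>\<A>. sat M f \<psi>" "\<forall>(M, f)\<in>\<B>. \<not> sat M f \<psi>"
    using \<psi>(3) by (auto simp: separates_def)
  ultimately show ?R
    using \<psi>(1,4) by (intro bexI[of _ \<psi>] conjI)
next
  assume ?R
  then obtain \<phi> where \<phi>: "\<phi> \<in> FO \<tau> ar QQ" "fm_size \<phi> \<le> s"
      "\<forall>(M, f)\<in>\<A> \<union> \<B>. fv \<phi> \<subseteq> dom f"
      "\<forall>(M, f)\<in>\<A>. sat M f \<phi>" "\<forall>(M, f)\<in>\<B>. \<not> sat M f \<phi>" by (elim bexE conjE)
  have "defined M f \<phi>" if "(M, f) \<in> \<A> \<union> \<B>" for M f
  proof -
    have "fv \<phi> \<subseteq> dom f" using bspec[OF \<phi>(3) that] by simp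
    then show ?thesis by (rule defined_if_fv)
  qed
  then have "separates \<phi> \<A> \<B>"
    unfolding separates_def using \<phi>(4,5) by fast
  then show ?L using \<phi>(1,2) by (intro bexI[of _ \<phi>] conjI)
qed

end

theory Submission
  imports Defs
begin

text \<open>
  Call a position \<open>(s, \<A>, \<B>)\<close> separable if some formula of size at most \<open>s\<close> separates \<open>\<A>\<close> from
  \<open>\<B>\<close>. The moves of the game mirror the formula constructors read from the outside in: a swap is
  a negation, a right splitting is a conjunction (each pair in \<open>\<B>\<close> refutes one of the two
  conjuncts), and a supplementing move is a quantifier, the chosen sets \<open>P (M, h)\<close> being the truth
  sets of the formula in its scope. Each move spends exactly the size of the constructor it
  mirrors. Hence separability obeys the same recursion as the existence of a win: an undecided
  position is separable iff some legal move has only separable successors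
  (\<open>separable_imp_good_move\<close> and \<open>separable_if_successors_separable\<close>).

  Given this recursion, both directions are routine game theory. If the initial position is
  separable, Player I keeps every position separable, and a separable position is never lost,
  because a formula of size 1 is atomic. Conversely, since the resource strictly decreases, a
  winning strategy can be read backwards from the atoms at the ends of its plays, which
  assembles a separating formula for every position that it visits.
\<close>

definition separable ::
    "'r set \<Rightarrow> ('r \<Rightarrow> nat) \<Rightarrow> 'a quantifier set \<Rightarrow> ('r, 'a) position \<Rightarrow> bool" where
  "separable \<tau> ar QQ =
     (\<lambda>(s, \<A>, \<B>). \<exists>\<phi>\<in>FO \<tau> ar QQ. fm_size \<phi> \<le> s \<and> separates \<phi> \<A> \<B>)"

lemma separableI:
  "\<phi> \<in> FO \<tau> ar QQ \<Longrightarrow> fm_size \<phi> \<le> s \<Longrightarrow> separates \<phi> \<A> \<B> \<Longrightarrow>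
     separable \<tau> ar QQ (s, \<A>, \<B>)"
  by (auto simp: separable_def)

lemma separableE:
  assumes "separable \<tau> ar QQ (s, \<A>, \<B>)"
  obtains \<phi> where "\<phi> \<in> FO \<tau> ar QQ" "fm_size \<phi> \<le> s" "separates \<phi> \<A> \<B>"
  using assms by (auto simp: separable_def)

lemma fm_size_pos: "1 \<le> fm_size \<phi>"
  by (induction \<phi>) auto

lemma fm_size_atomic: "atomic \<phi> \<Longrightarrow> fm_size \<phi> = 1"
  by (cases \<phi>) auto

lemma atomic_if_fm_size_le_1: "fm_size \<phi> \<le> 1 \<Longrightarrow> atomic \<phi>"
proof (cases \<phi>)
  case (And \<psi> \<chi>)
  assume "fm_size \<phi> \<le> 1"
  then show ?thesis using And fm_size_pos[of \<psi>] fm_size_pos[of \<chi>] by simp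
next
  case (Neg \<psi>)
  assume "fm_size \<phi> \<le> 1"
  then show ?thesis using Neg fm_size_pos[of \<psi>] by simp
next
  case (Quant Q x \<psi>)
  assume "fm_size \<phi> \<le> 1"
  then show ?thesis using Quant fm_size_pos[of \<psi>] by simp
qed auto

section \<open>Formula constructors and moves\<close>

lemma separates_Neg: "separates (Neg \<phi>) \<A> \<B> \<longleftrightarrow> separates \<phi> \<B> \<A>"
  by (auto simp: separates_def)

lemma separates_And:
  assumes "separates \<phi> \<A> \<C>" "separates \<psi> \<A> \<D>"
  shows "separates (And \<phi> \<psi>) \<A> (\<C> \<union> \<D>)"
  using assms by (fastforce simp: separates_def)

text \<open>
  The proviso \<open>defined\<close> allows one conjunct to be undefined where the other one is refuted, so
  \<open>\<B>\<close> is split according to which conjunct is both defined and false.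
\<close>

lemma separates_And_split:
  assumes "separates (And \<phi> \<psi>) \<A> \<B>"
  obtains \<C> \<D> where "\<C> \<union> \<D> = \<B>" "separates \<phi> \<A> \<C>" "separates \<psi> \<A> \<D>"
proof (rule that)
  let ?C = "{(M, f)\<in>\<B>. defined M f \<phi> \<and> \<not> sat M f \<phi>}"
  let ?D = "{(M, f)\<in>\<B>. defined M f \<psi> \<and> \<not> sat M f \<psi>}"
  show "?C \<union> ?D = \<B>" "separates \<phi> \<A> ?C" "separates \<psi> \<A> ?D"
    using assms by (auto simp: separates_def)
qed

lemma separates_suppD:
  assumes "separates \<phi> (supp_in x P \<C>) (supp_out x P \<C>)" "(M, h) \<in> \<C>" "a \<in> carrier M"
    and "P (M, h) \<subseteq> carrier M"
  shows "defined M (h(x \<mapsto> a)) \<phi>" and "sat M (h(x \<mapsto> a)) \<phi> \<longleftrightarrow> a \<in> P (M, h)"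
proof -
  have "if a \<in> P (M, h) then (M, h(x \<mapsto> a)) \<in> supp_in x P \<C>
        else (M, h(x \<mapsto> a)) \<in> supp_out x P \<C>"
    using assms(2,3) by (auto simp: supp_in_def supp_out_def)
  with assms(1) show "defined M (h(x \<mapsto> a)) \<phi>" "sat M (h(x \<mapsto> a)) \<phi> \<longleftrightarrow> a \<in> P (M, h)"
    by (auto simp: separates_def split: if_splits)
qed

text \<open>
  A formula separating the two supplemented classes has \<open>P (M, h)\<close> as its truth set in \<open>(M, h)\<close>:
  the first class forces it to be true on \<open>P (M, h)\<close>, the second one to be false on the rest of
  the domain. So the conditions that make the move legal are the semantics of the quantifier.
\<close>

lemma separates_Quant:
  assumes legal: "legal QQ (s, \<A>, \<B>) (Supplement Q x P)"
    and sep: "separates \<phi> (supp_in x P (\<A> \<union> \<B>)) (supp_out x P (\<A> \<union> \<B>))"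
  shows "separates (Quant Q x \<phi>) \<A> \<B>"
proof -
  have sub: "P (M, h) \<subseteq> carrier M" if "(M, h) \<in> \<A> \<union> \<B>" for M h
    using legal that by auto
  have truth_set: "{a \<in> carrier M. sat M (h(x \<mapsto> a)) \<phi>} = P (M, h)"
    if "(M, h) \<in> \<A> \<union> \<B>" for M h
    using separates_suppD(2)[OF sep that _ sub[OF that]] sub[OF that] by auto
  have "defined M h (Quant Q x \<phi>)" if "(M, h) \<in> \<A> \<union> \<B>" for M h
    using separates_suppD(1)[OF sep that _ sub[OF that]] by simp
  moreover have "sat M h (Quant Q x \<phi>) \<longleftrightarrow> (carrier M, P (M, h)) \<in> Q"
    if "(M, h) \<in> \<A> \<union> \<B>" for M h
    using truth_set[OF that] by simp
  ultimately show ?thesis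
    using legal unfolding separates_def by fastforce
qed

lemma separates_Quant_supp:
  fixes \<phi> :: "('r, 'a) fm" and \<A> \<B> :: "('r, 'a) pair set"
  assumes "separates (Quant Q x \<phi>) \<A> \<B>" "Q \<in> QQ"
  obtains P where "legal QQ (s, \<A>, \<B>) (Supplement Q x P)"
    and "separates \<phi> (supp_in x P (\<A> \<union> \<B>)) (supp_out x P (\<A> \<union> \<B>))"
proof
  define P :: "('r, 'a) pair \<Rightarrow> 'a set"
    where "P = (\<lambda>(M, h). {a \<in> carrier M. sat M (h(x \<mapsto> a)) \<phi>})"
  show "legal QQ (s, \<A>, \<B>) (Supplement Q x P)"
    using assms by (auto simp: P_def separates_def)
  show "separates \<phi> (supp_in x P (\<A> \<union> \<B>)) (supp_out x P (\<A> \<union> \<B>))"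
    using assms(1) by (auto simp: P_def separates_def supp_in_def supp_out_def)
qed

section \<open>The recursion for separability\<close>

lemma separable_not_won_by_II:
  assumes "separable \<tau> ar QQ p"
  shows "\<not> won_by_II \<tau> ar QQ p"
proof (cases p)
  case (fields s \<A> \<B>)
  then obtain \<phi> where "\<phi> \<in> FO \<tau> ar QQ" "fm_size \<phi> \<le> s" "separates \<phi> \<A> \<B>"
    using assms by (auto elim: separableE)
  then show ?thesis
    using fields atomic_if_fm_size_le_1[of \<phi>] by (auto simp: won_by_II_def won_by_I_def)
qed

lemma won_by_I_separable:
  assumes "won_by_I \<tau> ar QQ p" "1 \<le> fst p"
  shows "separable \<tau> ar QQ p"
proof (cases p)
  case (fields s \<A> \<B>)
  then obtain \<alpha> where "\<alpha> \<in> FO \<tau> ar QQ" "atomic \<alpha>" "separates \<alpha> \<A> \<B>"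
    using assms(1) by (auto simp: won_by_I_def)
  then show ?thesis
    using assms(2) fields by (auto intro!: separableI[of \<alpha>] simp: fm_size_atomic)
qed

text \<open>
  The outermost constructor of a separating formula names the move to play, and its immediate
  subformulas separate the successor positions.
\<close>

lemma separable_imp_good_move:
  assumes "separable \<tau> ar QQ p" "\<not> won_by_I \<tau> ar QQ p"
  shows "\<exists>m. legal QQ p m \<and> (\<forall>q\<in>successors p m. separable \<tau> ar QQ q)"
proof (cases p)
  case (fields s \<A> \<B>)
  obtain \<phi> where \<phi>: "\<phi> \<in> FO \<tau> ar QQ" "fm_size \<phi> \<le> s" "separates \<phi> \<A> \<B>"
    using assms(1) fields by (auto elim: separableE)
  have "\<not> atomic \<phi>"
    using assms(2) fields \<phi>(1,3) by (auto simp: won_by_I_def)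
  from \<phi>(1) show ?thesis
  proof cases
    case (3 \<psi>)
    then have "separable \<tau> ar QQ (s - 1, \<B>, \<A>)"
      using \<phi> by (intro separableI[of \<psi>]) (auto simp: separates_Neg)
    then show ?thesis
      using fields by (intro exI[of _ Swap]) simp
  next
    case (4 \<psi> \<chi>)
    then obtain \<C> \<D> where CD: "\<C> \<union> \<D> = \<B>" "separates \<psi> \<A> \<C>" "separates \<chi> \<A> \<D>"
      using \<phi>(3) by (auto elim: separates_And_split)
    \<comment> \<open>Any slack between the size of the formula and \<open>s\<close> goes to the second conjunct, as the two
      resources have to add up to exactly \<open>s\<close>.\<close>
    let ?u = "fm_size \<psi>" and ?v = "s - fm_size \<psi>"
    have sizes: "1 \<le> ?u" "fm_size \<chi> \<le> ?v" "1 \<le> ?v" "?u + ?v = s"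
      using \<phi>(2) 4 fm_size_pos[of \<psi>] fm_size_pos[of \<chi>] by auto
    have "separable \<tau> ar QQ (?u, \<A>, \<C>)" "separable \<tau> ar QQ (?v, \<A>, \<D>)"
      using 4 CD sizes by (auto intro: separableI)
    then show ?thesis
      using fields CD(1) sizes by (intro exI[of _ "Split ?u ?v \<C> \<D>"]) auto
  next
    case (5 Q \<psi> x)
    then obtain P where P: "legal QQ (s, \<A>, \<B>) (Supplement Q x P)"
        "separates \<psi> (supp_in x P (\<A> \<union> \<B>)) (supp_out x P (\<A> \<union> \<B>))"
      using \<phi>(3) by (auto elim: separates_Quant_supp)
    have "separable \<tau> ar QQ (s - 1, supp_in x P (\<A> \<union> \<B>), supp_out x P (\<A> \<union> \<B>))"
      using 5 \<phi>(2) P(2) by (intro separableI[of \<psi>]) auto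
    then show ?thesis
      using fields P(1) by (intro exI[of _ "Supplement Q x P"]) simp
  qed (use \<open>\<not> atomic \<phi>\<close> in auto)
qed

lemma separable_if_successors_separable:
  assumes legal: "legal QQ p m" and succ: "\<And>q. q \<in> successors p m \<Longrightarrow> separable \<tau> ar QQ q"
  shows "separable \<tau> ar QQ p"
proof (cases p)
  case (fields s \<A> \<B>)
  show ?thesis
  proof (cases m)
    case Swap
    then have "separable \<tau> ar QQ (s - 1, \<B>, \<A>)"
      using fields by (intro succ) simp
    then obtain \<phi> where "\<phi> \<in> FO \<tau> ar QQ" "fm_size \<phi> \<le> s - 1" "separates \<phi> \<B> \<A>"
      by (rule separableE)
    then show ?thesis
      using fields fm_size_pos[of \<phi>]
      by (auto intro!: separableI[of "Neg \<phi>"] FO.intros simp: separates_Neg)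
  next
    case (Split u v \<C> \<D>)
    then have "separable \<tau> ar QQ (u, \<A>, \<C>)" "separable \<tau> ar QQ (v, \<A>, \<D>)"
      using fields by (auto intro!: succ)
    then obtain \<phi> \<psi> where
      "\<phi> \<in> FO \<tau> ar QQ" "fm_size \<phi> \<le> u" "separates \<phi> \<A> \<C>"
      "\<psi> \<in> FO \<tau> ar QQ" "fm_size \<psi> \<le> v" "separates \<psi> \<A> \<D>"
      by (elim separableE)
    then show ?thesis
      using legal fields Split separates_And[of \<phi> \<A> \<C> \<psi> \<D>]
      by (auto intro!: separableI[of "And \<phi> \<psi>"] FO.intros)
  next
    case (Supplement Q x P)
    then have "separable \<tau> ar QQ (s - 1, supp_in x P (\<A> \<union> \<B>), supp_out x P (\<A> \<union> \<B>))"
      using fields by (intro succ) simp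
    then obtain \<phi> where "\<phi> \<in> FO \<tau> ar QQ" "fm_size \<phi> \<le> s - 1"
        "separates \<phi> (supp_in x P (\<A> \<union> \<B>)) (supp_out x P (\<A> \<union> \<B>))"
      by (rule separableE)
    moreover from this have "separates (Quant Q x \<phi>) \<A> \<B>"
      using legal fields Supplement by (intro separates_Quant) auto
    ultimately show ?thesis
      using legal fields Supplement fm_size_pos[of \<phi>]
      by (auto intro!: separableI[of "Quant Q x \<phi>"] FO.intros)
  qed
qed

lemma successor_resource:
  assumes "legal QQ p m" "q \<in> successors p m" "1 \<le> fst p" "fst p \<noteq> 1"
  shows "1 \<le> fst q" and "fst q < fst p"
  using assms by (cases p; cases m; auto)+

section \<open>Strategies\<close>

lemma winning_strategy_if_separable:
  assumes "separable \<tau> ar QQ p"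
  shows "\<exists>\<sigma>. winning_strategy \<tau> ar QQ \<sigma> p"
proof -
  define good where
    "good q m \<longleftrightarrow> legal QQ q m \<and> (\<forall>r\<in>successors q m. separable \<tau> ar QQ r)" for q m
  define \<sigma> where "\<sigma> h = (SOME m. good (last h) m)" for h
  have good: "good (last h) (\<sigma> h)"
    if "separable \<tau> ar QQ (last h)" "\<not> won_by_I \<tau> ar QQ (last h)" for h
    using separable_imp_good_move[OF that] unfolding \<sigma>_def good_def by (rule someI_ex)
  have "separable \<tau> ar QQ (last h)" if "consistent \<tau> ar QQ \<sigma> p h" for h
    using that
  proof induction
    case start
    then show ?case using assms by simp
  next
    case (step h q)
    then show ?case using good by (auto simp: good_def)
  qed
  then have "winning_strategy \<tau> ar QQ \<sigma> p"
    unfolding winning_strategy_def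
    using good separable_not_won_by_II good_def by blast
  then show ?thesis by blast
qed

text \<open>
  The induction runs over all histories arising from the strategy, ordered by the remaining
  resource. Its positivity has to be carried along: an atomic formula separating a position with
  resource 0 would exceed the size bound.
\<close>

lemma separable_along_winning_strategy:
  assumes win: "winning_strategy \<tau> ar QQ \<sigma> p"
    and "consistent \<tau> ar QQ \<sigma> p h" "1 \<le> fst (last h)"
  shows "separable \<tau> ar QQ (last h)"
  using assms(2,3)
proof (induction "fst (last h)" arbitrary: h rule: less_induct)
  case less
  show ?case
  proof (cases "won_by_I \<tau> ar QQ (last h)")
    case True
    then show ?thesis using less.prems(2) by (rule won_by_I_separable)
  next
    case False
    then have undecided: "\<not> won_by_II \<tau> ar QQ (last h)" and legal: "legal QQ (last h) (\<sigma> h)"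
      using win less.prems(1) by (auto simp: winning_strategy_def)
    have "fst (last h) \<noteq> 1"
      using False undecided by (simp add: won_by_II_def)
    note resource = successor_resource[OF legal _ less.prems(2) this]
    have "separable \<tau> ar QQ q" if q: "q \<in> successors (last h) (\<sigma> h)" for q
      using less.hyps[of "h @ [q]"] resource[OF q]
        consistent.step[OF less.prems(1) False undecided legal q] by simp
    with legal show ?thesis by (rule separable_if_successors_separable)
  qed
qed

theorem theorem4p2:
  fixes \<tau> :: "'r set" and ar :: "'r \<Rightarrow> nat"
    and QQ :: "'a quantifier set"
    and \<A> \<B> :: "('r, 'a) pair set" and s :: nat
  assumes "finite \<tau>"
    and "finite QQ" and "\<forall>Q\<in>QQ. is_quantifier Q"
    and "\<A> \<subseteq> pairs \<tau> ar" and "\<B> \<subseteq> pairs \<tau> ar"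
    and "s \<ge> 1"
  shows "(\<exists>\<sigma>. winning_strategy \<tau> ar QQ \<sigma> (s, \<A>, \<B>)) \<longleftrightarrow>
         (\<exists>\<phi>\<in>FO \<tau> ar QQ. fm_size \<phi> \<le> s \<and> separates \<phi> \<A> \<B>)"
proof -
  have "separable \<tau> ar QQ (s, \<A>, \<B>)"
    if "winning_strategy \<tau> ar QQ \<sigma> (s, \<A>, \<B>)" for \<sigma>
    using separable_along_winning_strategy[OF that consistent.start] \<open>s \<ge> 1\<close> by simp
  then have "(\<exists>\<sigma>. winning_strategy \<tau> ar QQ \<sigma> (s, \<A>, \<B>)) \<longleftrightarrow> separable \<tau> ar QQ (s, \<A>, \<B>)"
    using winning_strategy_if_separable by blast
  then show ?thesis by (simp add: separable_def)
qed

end
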